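(* Let $R$ be a commutative ring, $\mathfrak a\subseteq R$ an ideal and $M$ an $R$-module. Then: a) $\operatorname{Ass}^{\mathrm f}_R(M)\cap\operatorname{Var}(\mathfrak a)=\emptyset\Rightarrow\overline\Gamma_{\mathfrak a}(M)=0\Rightarrow\Gamma_{\mathfrak a}(M)=0\Rightarrow\operatorname{Ass}_R(M)\cap\operatorname{Var}(\mathfrak a)=\emptyset$; b) $\Gamma_{\mathfrak a}(M)=M\Rightarrow\operatorname{Ass}^{\mathrm f}_R(M)\subseteq\operatorname{Var}(\mathfrak a)\Leftrightarrow\overline\Gamma_{\mathfrak a}(M)=M$.
   Context: Rings are commutative with unit (possibly zero). For a ring $R$, an ideal $\mathfrak a\subseteq R$ and an $R$-module $M$: $\operatorname{Var}(\mathfrak a)=\{\mathfrak p\in\operatorname{Spec}(R)\mid\mathfrak a\subseteq\mathfrak p\}$; $\Gamma_{\mathfrak a}(M)=\{x\in M\mid\exists n\in\mathbb N:\mathfrak a^n\subseteq(0:_Rx)\}$ (small $\mathfrak a$-torsion submodule); $\overline\Gamma_{\mathfrak a}(M)=\{x\in M\mid\mathfrak a\subseteq\sqrt{(0:_Rx)}\}$ (large $\mathfrak a$-torsion submodule); $\operatorname{Ass}_R(M)=\{\mathfrak p\in\operatorname{Spec}(R)\mid\exists x\in M:\mathfrak p=(0:_Rx)\}$; $\operatorname{Ass}^{\mathrm f}_R(M)=\{\mathfrak p\in\operatorname{Spec}(R)\mid\exists x\in M:\mathfrak p\in\min(0:_Rx)\}$ (weak assassin), where $\min(\mathfrak b)$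 is the set of minimal elements of $\operatorname{Var}(\mathfrak b)$. *)

theory Defs
  imports "HOL-Algebra.Algebra"
begin

definition Spec :: "('a, 'm) ring_scheme \<Rightarrow> 'a set set" where
  "Spec R = {p. primeideal p R}"

definition Var :: "('a, 'm) ring_scheme \<Rightarrow> 'a set \<Rightarrow> 'a set set" where
  "Var R \<aa> = {p \<in> Spec R. \<aa> \<subseteq> p}"

definition min_primes :: "('a, 'm) ring_scheme \<Rightarrow> 'a set \<Rightarrow> 'a set set" where
  "min_primes R \<bb> = {p \<in> Var R \<bb>. \<forall>q \<in> Var R \<bb>. q \<subseteq> p \<longrightarrow> q = p}"

definition radical :: "('a, 'm) ring_scheme \<Rightarrow> 'a set \<Rightarrow> 'a set" where
  "radical R \<bb> = {r \<in> carrier R. \<exists>n::nat. r [^]\<^bsub>R\<^esub> n \<in> \<bb>}"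

definition annihilator :: "('a, 'm) ring_scheme \<Rightarrow> ('a, 'b, 'n) module_scheme \<Rightarrow> 'b \<Rightarrow> 'a set" where
  "annihilator R M x = {r \<in> carrier R. r \<odot>\<^bsub>M\<^esub> x = \<zero>\<^bsub>M\<^esub>}"

text \<open>Powers of an ideal are taken in \<^term>\<open>ideals_set R\<close>, whose multiplication is the product
  of ideals and whose unit is \<^term>\<open>carrier R\<close>; thus the zeroth power of an ideal is the whole ring.\<close>

definition small_torsion ::
  "('a, 'm) ring_scheme \<Rightarrow> 'a set \<Rightarrow> ('a, 'b, 'n) module_scheme \<Rightarrow> 'b set" where
  "small_torsion R \<aa> M =
     {x \<in> carrier M. \<exists>n::nat. \<aa> [^]\<^bsub>ideals_set R\<^esub> n \<subseteq> annihilator R M x}"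

definition large_torsion ::
  "('a, 'm) ring_scheme \<Rightarrow> 'a set \<Rightarrow> ('a, 'b, 'n) module_scheme \<Rightarrow> 'b set" where
  "large_torsion R \<aa> M = {x \<in> carrier M. \<aa> \<subseteq> radical R (annihilator R M x)}"

definition Ass :: "('a, 'm) ring_scheme \<Rightarrow> ('a, 'b, 'n) module_scheme \<Rightarrow> 'a set set" where
  "Ass R M = {p \<in> Spec R. \<exists>x \<in> carrier M. p = annihilator R M x}"

definition weak_Ass :: "('a, 'm) ring_scheme \<Rightarrow> ('a, 'b, 'n) module_scheme \<Rightarrow> 'a set set" where
  "weak_Ass R M = {p \<in> Spec R. \<exists>x \<in> carrier M. p \<in> min_primes R (annihilator R M x)}"

end

theory Submission
  imports Defs
begin

text \<open>The weak assassin is the union of the sets \<open>min (0 : x)\<close> over all \<open>x\<close> in \<open>M\<close>, and large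
  torsion can be read off from the same sets: since the radical of an ideal is the intersection of
  its minimal primes, \<open>x\<close> is a large \<open>\<aa>\<close>-torsion element if and only if all minimal primes of
  \<open>(0 : x)\<close> contain \<open>\<aa>\<close> (lemma \<open>large_torsion_iff_min_primes\<close>). Quantifying over all \<open>x\<close> turns
  this into the equivalence in (b). For the first implication in (a), a nonzero \<open>x\<close> has a proper
  annihilator, hence at least one minimal prime, and if \<open>x\<close> is large torsion this prime lies in
  the weak assassin and contains \<open>\<aa>\<close>.

  The implications involving small torsion are elementary. Small torsion is contained in large
  torsion because the \<open>n\<close>-th power of an element of \<open>\<aa>\<close> lies in \<open>\<aa>\<^sup>n\<close>; and if an associated
  prime \<open>(0 : x)\<close> contains \<open>\<aa>\<close>, then \<open>x\<close> is a nonzero element killed by \<open>\<aa>\<close>, so it is small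
  torsion.

  The substance is therefore that an element outside the radical of an ideal \<open>I\<close> avoids some
  minimal prime of \<open>I\<close>. It takes two applications of Zorn's lemma: one yields a prime above \<open>I\<close>
  that avoids the powers of the element (lemma \<open>exists_prime_disjoint\<close>), the other shrinks it to a
  minimal prime (lemma \<open>exists_min_prime_below\<close>).\<close>

text \<open>An ideal \<open>P\<close> that is maximal among the ideals above \<open>I\<close> disjoint from \<open>S\<close> is prime. For \<open>s\<close> in
  \<open>S\<close> the colon ideal \<open>(P : s)\<close> is disjoint from \<open>S\<close> as well, so it equals \<open>P\<close>. If now \<open>a b\<close> lies
  in \<open>P\<close> but \<open>a\<close> does not, then \<open>(P : b)\<close> is strictly larger than \<open>P\<close>, so it contains some \<open>s\<close> in
  \<open>S\<close>, which says that \<open>b\<close> lies in \<open>(P : s) = P\<close>.\<close>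

lemma (in cring) exists_prime_disjoint:
  assumes I: "ideal I R" and S: "S \<subseteq> carrier R" "\<one> \<in> S"
    and S_mult: "\<And>s t. s \<in> S \<Longrightarrow> t \<in> S \<Longrightarrow> s \<otimes> t \<in> S"
    and disj: "I \<inter> S = {}"
  obtains P where "primeideal P R" "I \<subseteq> P" "P \<inter> S = {}"
proof -
  define A where "A = {J. ideal J R \<and> I \<subseteq> J \<and> J \<inter> S = {}}"
  have "\<exists>P\<in>A. \<forall>J\<in>A. P \<subseteq> J \<longrightarrow> J = P"
  proof (rule subset_Zorn_nonempty)
    show "A \<noteq> {}" using I disj by (auto simp: A_def)
  next
    fix C assume "C \<noteq> {}" and C: "subset.chain A C"
    then have "subset.chain {J. ideal J R} C"
      by (auto simp: A_def pred_on.chain_def)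
    from chain_Union_is_ideal[OF this] \<open>C \<noteq> {}\<close> have "ideal (\<Union>C) R" by simp
    moreover have "I \<subseteq> J \<and> J \<inter> S = {}" if "J \<in> C" for J
      using C that unfolding A_def pred_on.chain_def by blast
    ultimately show "\<Union>C \<in> A"
      using \<open>C \<noteq> {}\<close> unfolding A_def by blast
  qed
  then obtain P where "P \<in> A" and max: "\<And>J. J \<in> A \<Longrightarrow> P \<subseteq> J \<Longrightarrow> J = P" by blast
  then have P: "ideal P R" "I \<subseteq> P" "P \<inter> S = {}" by (auto simp: A_def)
  have P_max: "J = P" if "ideal J R" "P \<subseteq> J" "J \<inter> S = {}" for J
    using that P(2) by (intro max) (auto simp: A_def)
  have colon_ideal: "ideal {x \<in> carrier R. b \<otimes> x \<in> P} R" if "b \<in> carrier R" for b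
    using ideal.helper_max_prime[OF P(1) is_cring that] .
  have colon_ge: "P \<subseteq> {x \<in> carrier R. b \<otimes> x \<in> P}" if "b \<in> carrier R" for b
    using that ideal.I_l_closed[OF P(1)] ideal.Icarr[OF P(1)] by blast
  have colon_S: "{x \<in> carrier R. s \<otimes> x \<in> P} = P" if "s \<in> S" for s
    using that S P(3) S_mult by (intro P_max colon_ideal colon_ge) blast+
  have "primeideal P R"
  proof (rule primeidealI[OF P(1) is_cring])
    show "carrier R \<noteq> P" using S P(3) by blast
  next
    fix a b assume ab: "a \<in> carrier R" "b \<in> carrier R" "a \<otimes> b \<in> P"
    have "b \<in> P" if "a \<notin> P"
    proof -
      note \<open>a \<notin> P\<close>
      moreover have "a \<in> {x \<in> carrier R. b \<otimes> x \<in> P}" using ab by (simp add: m_comm)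
      ultimately have "{x \<in> carrier R. b \<otimes> x \<in> P} \<noteq> P" by blast
      with P_max[OF colon_ideal colon_ge] ab(2) obtain s where "s \<in> S" "b \<otimes> s \<in> P" by blast
      moreover from this S(1) ab(2) have "s \<otimes> b \<in> P" by (metis m_comm subsetD)
      ultimately show "b \<in> P" using colon_S ab(2) by blast
    qed
    then show "a \<in> P \<or> b \<in> P" by blast
  qed
  with P that show thesis by blast
qed

text \<open>The intersection of a chain of primes is prime: if it contains neither \<open>a\<close> nor \<open>b\<close>, then the
  smaller of a prime missing \<open>a\<close> and a prime missing \<open>b\<close> misses both, hence also \<open>a b\<close>.\<close>

lemma (in cring) primeideal_Inter_chain:
  assumes "C \<noteq> {}" and prime: "\<And>p. p \<in> C \<Longrightarrow> primeideal p R"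
    and chain: "\<And>p q. p \<in> C \<Longrightarrow> q \<in> C \<Longrightarrow> p \<subseteq> q \<or> q \<subseteq> p"
  shows "primeideal (\<Inter>C) R"
proof (rule primeidealI[OF _ is_cring])
  show "ideal (\<Inter>C) R"
    using assms(1) prime by (intro i_Intersect) (auto simp: primeideal_def)
  obtain p where "p \<in> C" using assms(1) by blast
  then interpret primeideal p R by (rule prime)
  show "carrier R \<noteq> \<Inter>C" using I_notcarr a_subset \<open>p \<in> C\<close> by blast
next
  fix a b assume ab: "a \<in> carrier R" "b \<in> carrier R" "a \<otimes> b \<in> \<Inter>C"
  show "a \<in> \<Inter>C \<or> b \<in> \<Inter>C"
  proof (rule ccontr)
    assume "\<not> (a \<in> \<Inter>C \<or> b \<in> \<Inter>C)"
    then obtain p q where "p \<in> C" "a \<notin> p" "q \<in> C" "b \<notin> q" by blast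
    with chain obtain r where "r \<in> C" "a \<notin> r" "b \<notin> r" by blast
    with ab primeideal.I_prime[OF prime] show False by blast
  qed
qed

lemma (in cring) exists_min_prime_below:
  assumes "p \<in> Var R I"
  obtains q where "q \<in> min_primes R I" "q \<subseteq> p"
proof -
  define A where "A = {q \<in> Var R I. q \<subseteq> p}"
  have "\<exists>m\<in>A. \<forall>q\<in>A. m \<supseteq> q \<longrightarrow> q = m"
  proof (rule predicate_Zorn)
    show "partial_order_on A (relation_of (\<lambda>x y. x \<supseteq> y) A)"
      by (auto simp: partial_order_on_def preorder_on_def refl_on_def trans_def antisym_def
          relation_of_def)
  next
    fix C assume "C \<in> Chains (relation_of (\<lambda>x y. x \<supseteq> y) A)"
    then have C: "C \<subseteq> A" "\<And>q q'. q \<in> C \<Longrightarrow> q' \<in> C \<Longrightarrow> q \<subseteq> q' \<or> q' \<subseteq> q"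
      by (auto simp: Chains_def relation_of_def)
    show "\<exists>u\<in>A. \<forall>q\<in>C. q \<supseteq> u"
    proof (cases "C = {}")
      case True
      then show ?thesis using assms by (auto simp: A_def)
    next
      case False
      have "primeideal (\<Inter>C) R"
        using C by (intro primeideal_Inter_chain[OF False]) (auto simp: A_def Var_def Spec_def)
      with C(1) False have "\<Inter>C \<in> A"
        by (force simp: A_def Var_def Spec_def)
      then show ?thesis by blast
    qed
  qed
  then obtain q where "q \<in> A" "\<And>q'. q' \<in> A \<Longrightarrow> q' \<subseteq> q \<Longrightarrow> q' = q" by blast
  then show thesis
    by (intro that[of q]) (auto simp: A_def min_primes_def)
qed

lemma (in cring) radical_subset_prime:
  assumes "p \<in> Var R I"
  shows "radical R I \<subseteq> p"
proof
  fix r assume "r \<in> radical R I"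
  then obtain n :: nat where r: "r \<in> carrier R" and n: "r [^] n \<in> I"
    by (auto simp: radical_def)
  interpret primeideal p R using assms by (simp add: Var_def Spec_def)
  have "r [^] n \<in> p" using n assms by (auto simp: Var_def)
  then show "r \<in> p"
  proof (induction n)
    case 0
    then show ?case using one_imp_carrier I_notcarr by simp
  next
    case (Suc n)
    then show ?case using I_prime[of "r [^] n" r] r by auto
  qed
qed

text \<open>This is the fact that the radical of an ideal is the intersection of its minimal primes, in the
  form that compares it with a set \<open>A\<close>.\<close>

lemma (in cring) subset_radical_iff_min_primes:
  assumes I: "ideal I R" and A: "A \<subseteq> carrier R"
  shows "A \<subseteq> radical R I \<longleftrightarrow> min_primes R I \<subseteq> Var R A"
proof
  assume "A \<subseteq> radical R I"
  with radical_subset_prime[of _ I] show "min_primes R I \<subseteq> Var R A"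
    by (fastforce simp: min_primes_def Var_def)
next
  assume min: "min_primes R I \<subseteq> Var R A"
  show "A \<subseteq> radical R I"
  proof
    fix r assume "r \<in> A"
    with A have r: "r \<in> carrier R" by blast
    show "r \<in> radical R I"
    proof (rule ccontr)
      assume "r \<notin> radical R I"
      then have disj: "I \<inter> range (\<lambda>n::nat. r [^] n) = {}" using r by (auto simp: radical_def)
      have one: "\<one> \<in> range (\<lambda>n::nat. r [^] n)" using nat_pow_0[of r] by (metis rangeI)
      obtain p where p: "primeideal p R" "I \<subseteq> p" "p \<inter> range (\<lambda>n::nat. r [^] n) = {}"
        using r by (rule_tac exists_prime_disjoint[OF I _ one _ disj]) (auto simp: nat_pow_mult)
      then have "p \<in> Var R I" by (simp add: Var_def Spec_def)
      then obtain q where q: "q \<in> min_primes R I" "q \<subseteq> p"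
        by (rule exists_min_prime_below)
      with min \<open>r \<in> A\<close> have "r \<in> p" by (auto simp: Var_def)
      moreover have "r \<in> range (\<lambda>n::nat. r [^] n)" using nat_pow_eone[OF r] by (metis rangeI)
      ultimately show False using p(3) by blast
    qed
  qed
qed

lemma (in module) annihilator_ideal:
  assumes x: "x \<in> carrier M"
  shows "ideal (annihilator R M x) R"
proof (rule idealI[OF R.ring_axioms])
  show "subgroup (annihilator R M x) (add_monoid R)"
  proof
    fix a assume "a \<in> annihilator R M x"
    then show "inv\<^bsub>add_monoid R\<^esub> a \<in> annihilator R M x"
      using x smult_l_minus[of a x] by (simp add: annihilator_def flip: a_inv_def)
  qed (use x in \<open>auto simp: annihilator_def smult_l_distr smult_l_null\<close>)
next
  fix a r assume "a \<in> annihilator R M x" "r \<in> carrier R"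
  then show "r \<otimes> a \<in> annihilator R M x" "a \<otimes> r \<in> annihilator R M x"
    using x by (auto simp: annihilator_def smult_assoc1 smult_r_null R.m_comm[of a r])
qed

lemma (in module) one_in_annihilator_iff:
  assumes "x \<in> carrier M"
  shows "\<one> \<in> annihilator R M x \<longleftrightarrow> x = \<zero>\<^bsub>M\<^esub>"
  using assms by (simp add: annihilator_def)

lemma (in module) large_torsion_iff_min_primes:
  assumes "ideal \<aa> R" and x: "x \<in> carrier M"
  shows "x \<in> large_torsion R \<aa> M \<longleftrightarrow> min_primes R (annihilator R M x) \<subseteq> Var R \<aa>"
  using R.subset_radical_iff_min_primes[OF annihilator_ideal[OF x]] assms
  by (simp add: large_torsion_def additive_subgroup.a_subset ideal.axioms(1))

text \<open>Taking \<open>A = {\<one>}\<close> in the description of the radical: an ideal with no minimal primes contains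
  \<open>\<one>\<close>.\<close>

lemma (in module) min_primes_annihilator_nonempty:
  assumes x: "x \<in> carrier M" and "x \<noteq> \<zero>\<^bsub>M\<^esub>"
  shows "min_primes R (annihilator R M x) \<noteq> {}"
proof
  assume "min_primes R (annihilator R M x) = {}"
  then have "{\<one>} \<subseteq> radical R (annihilator R M x)"
    by (subst R.subset_radical_iff_min_primes[OF annihilator_ideal[OF x]]) auto
  then show False using assms by (simp add: radical_def one_in_annihilator_iff)
qed

lemma weak_Ass_eq_Union:
  "weak_Ass R M = (\<Union>x\<in>carrier M. min_primes R (annihilator R M x))"
  by (auto simp: weak_Ass_def min_primes_def Var_def)

lemma power_in_ideal_power:
  fixes R (structure)
  assumes "ideal \<aa> R" and r: "r \<in> \<aa>"
  shows "r [^] (n::nat) \<in> \<aa> [^]\<^bsub>ideals_set R\<^esub> n"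
proof -
  interpret ideal \<aa> R by fact
  show ?thesis
    by (induction n) (auto simp: nat_pow_def ideals_set_def intro: ideal_prod.prod r)
qed

lemma small_torsion_subset_large_torsion:
  assumes "ideal \<aa> R"
  shows "small_torsion R \<aa> M \<subseteq> large_torsion R \<aa> M"
  using power_in_ideal_power[OF assms] ideal.Icarr[OF assms]
  unfolding small_torsion_def large_torsion_def radical_def by blast

text \<open>The exponent 1 is a witness: by recursion \<open>\<aa>\<^sup>1\<close> is the product of the unit ideal with \<open>\<aa>\<close>,
  which is contained in \<open>\<aa>\<close>.\<close>

lemma (in cring) small_torsionI:
  assumes \<aa>: "ideal \<aa> R" and "x \<in> carrier M" "\<aa> \<subseteq> annihilator R M x"
  shows "x \<in> small_torsion R \<aa> M"
proof -
  have "\<aa> [^]\<^bsub>ideals_set R\<^esub> (1::nat) \<subseteq> \<aa>"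
    using ideal_prod_inter[OF oneideal \<aa>] by (simp add: nat_pow_def ideals_set_def)
  with assms show ?thesis unfolding small_torsion_def by blast
qed

theorem mainTheorem1:
  fixes R :: "('a, 'm) ring_scheme"
    and M :: "('a, 'b, 'n) module_scheme"
    and \<aa> :: "'a set"
  assumes "cring R" and "module R M" and "ideal \<aa> R"
  shows
    "((weak_Ass R M \<inter> Var R \<aa> = {} \<longrightarrow> large_torsion R \<aa> M = {\<zero>\<^bsub>M\<^esub>}) \<and>
      (large_torsion R \<aa> M = {\<zero>\<^bsub>M\<^esub>} \<longrightarrow> small_torsion R \<aa> M = {\<zero>\<^bsub>M\<^esub>}) \<and>
      (small_torsion R \<aa> M = {\<zero>\<^bsub>M\<^esub>} \<longrightarrow> Ass R M \<inter> Var R \<aa> = {}))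
     \<and>
     ((small_torsion R \<aa> M = carrier M \<longrightarrow> weak_Ass R M \<subseteq> Var R \<aa>) \<and>
      (weak_Ass R M \<subseteq> Var R \<aa> \<longleftrightarrow> large_torsion R \<aa> M = carrier M))"
proof -
  interpret module R M by fact
  note large = large_torsion_iff_min_primes[OF assms(3)]
  have small_le_large: "small_torsion R \<aa> M \<subseteq> large_torsion R \<aa> M"
    by (rule small_torsion_subset_large_torsion[OF assms(3)])
  have large_le: "large_torsion R \<aa> M \<subseteq> carrier M"
    by (auto simp: large_torsion_def)
  have zero_small: "\<zero>\<^bsub>M\<^esub> \<in> small_torsion R \<aa> M"
    using ideal.Icarr[OF assms(3)]
    by (intro R.small_torsionI[OF assms(3)]) (auto simp: annihilator_def smult_r_null)
  have weak_iff: "weak_Ass R M \<subseteq> Var R \<aa> \<longleftrightarrow> large_torsion R \<aa> M = carrier M"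
    using large large_le unfolding weak_Ass_eq_Union by blast
  have "large_torsion R \<aa> M = {\<zero>\<^bsub>M\<^esub>}" if disj: "weak_Ass R M \<inter> Var R \<aa> = {}"
  proof -
    have "x = \<zero>\<^bsub>M\<^esub>" if x: "x \<in> large_torsion R \<aa> M" for x
    proof -
      have "x \<in> carrier M" using x large_le by blast
      with x disj have "min_primes R (annihilator R M x) = {}"
        unfolding large[OF \<open>x \<in> carrier M\<close>] weak_Ass_eq_Union by blast
      with \<open>x \<in> carrier M\<close> show ?thesis using min_primes_annihilator_nonempty by blast
    qed
    with zero_small small_le_large show ?thesis by blast
  qed
  moreover have "small_torsion R \<aa> M = {\<zero>\<^bsub>M\<^esub>}" if "large_torsion R \<aa> M = {\<zero>\<^bsub>M\<^esub>}"
    using that small_le_large zero_small by blast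
  moreover have "Ass R M \<inter> Var R \<aa> = {}" if small: "small_torsion R \<aa> M = {\<zero>\<^bsub>M\<^esub>}"
  proof (rule ccontr)
    assume "Ass R M \<inter> Var R \<aa> \<noteq> {}"
    then obtain x where x: "x \<in> carrier M" and prime: "primeideal (annihilator R M x) R"
      and "\<aa> \<subseteq> annihilator R M x"
      by (auto simp: Ass_def Var_def Spec_def)
    then have "x = \<zero>\<^bsub>M\<^esub>" using R.small_torsionI[OF assms(3) x] small by blast
    then have "\<one>\<^bsub>R\<^esub> \<in> annihilator R M x" using one_in_annihilator_iff[OF x] by simp
    with prime show False
      using ideal.one_imp_carrier primeideal.axioms(1) primeideal.I_notcarr by metis
  qed
  moreover have "weak_Ass R M \<subseteq> Var R \<aa>" if "small_torsion R \<aa> M = carrier M"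
    using that small_le_large large_le weak_iff by blast
  ultimately show ?thesis using weak_iff by blast
qed

end
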